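(* Let a strict complete stable marriage instance of size $n$ be given, with set of men $M$, set of women $W$ and rank-complement matrices $A,B$. Let $S_m\subseteq M$ and $S_w\subseteq W$ be nonempty, with $a=|S_m|$ and $b=|S_w|$. Write the depths $\alpha_i$ ($i\in S_m$) increasingly as $\alpha_{(1)}\le\cdots\le\alpha_{(a)}$. If $\alpha_{(t)}\ge t$ for every $1\le t\le a$, then the family $\{C_i(S_w):i\in S_m\}$ satisfies the full Hall condition, i.e. $|\bigcup_{i\in X}C_i(S_w)|\ge|X|$ for every $X\subseteq S_m$, and hence the bipartite graph on $(S_m,T_w)$ with $i\sim w$ iff $r_M(i,w)>\max_{j\in S_w}r_M(i,j)$ (equivalently $w\in C_i(S_w)$) has a matching saturating $S_m$. Symmetrically, write the depths $\delta_j$ ($j\in S_w$) increasingly as $\delta_{(1)}\le\cdots\le\delta_{(b)}$. If $\delta_{(t)}\ge t$ for every $1\le t\le b$, then the family $\{D_j(S_m):j\in S_w\}$ satisfies the full Hall condition, and hence the bipartite graph on $(S_w,T_m)$ with $j\sim i'$ iff $r_W(j,i')>\max_{i\in S_m}r_W(j,i)$ (equivalently $i'\in D_j(S_m)$) has a matching saturating $S_w$.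
   Context: In an instance of size $n$ there are $n$ men and $n$ women, each with a strict complete preference order on the other side; $r_M(i,j)\in\{1,\dots,n\}$ is the rank of woman $j$ in man $i$'s list and $r_W(j,i)\in\{1,\dots,n\}$ the rank of man $i$ in woman $j$'s list (1 is best). The rank-complement matrices are $A_{ij}=n-r_M(i,j)$ and $B_{ij}=n-r_W(j,i)$. Put $T_w=W\setminus S_w$, $T_m=M\setminus S_m$, $\alpha_i=\min_{j\in S_w}A_{ij}$, $C_i(S_w)=\{w\in T_w: A_{iw}<\alpha_i\}$, $\delta_j=\min_{i\in S_m}B_{ij}$, $D_j(S_m)=\{i\in T_m: B_{ij}<\delta_j\}$. *)

theory Defs
  imports Main "HOL-Library.Multiset"
begin

text \<open>
  \<open>(j, k) \<in> men_pref I i\<close> means that man \<open>i\<close> strictly prefers woman \<open>j\<close> to woman \<open>k\<close>;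
  likewise for \<open>women_pref\<close>.
\<close>

record ('m, 'w) marriage =
  men :: "'m set"
  women :: "'w set"
  men_pref :: "'m \<Rightarrow> ('w \<times> 'w) set"
  women_pref :: "'w \<Rightarrow> ('m \<times> 'm) set"

definition marriage_instance :: "nat \<Rightarrow> ('m, 'w) marriage \<Rightarrow> bool" where
  "marriage_instance n I \<longleftrightarrow>
     finite (men I) \<and> card (men I) = n \<and>
     finite (women I) \<and> card (women I) = n \<and>
     (\<forall>i\<in>men I. men_pref I i \<subseteq> women I \<times> women I \<and>
        strict_linear_order_on (women I) (men_pref I i)) \<and>
     (\<forall>j\<in>women I. women_pref I j \<subseteq> men I \<times> men I \<and>
        strict_linear_order_on (men I) (women_pref I j))"

definition rank_in :: "'a set \<Rightarrow> ('a \<times> 'a) set \<Rightarrow> 'a \<Rightarrow> nat" where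
  "rank_in X r x = card {y \<in> X. (y, x) \<in> r} + 1"

definition r_M :: "('m, 'w) marriage \<Rightarrow> 'm \<Rightarrow> 'w \<Rightarrow> nat" where
  "r_M I i j = rank_in (women I) (men_pref I i) j"

definition r_W :: "('m, 'w) marriage \<Rightarrow> 'w \<Rightarrow> 'm \<Rightarrow> nat" where
  "r_W I j i = rank_in (men I) (women_pref I j) i"

text \<open>Both matrices are indexed by (man, woman), in this order.\<close>

definition A_mat :: "nat \<Rightarrow> ('m, 'w) marriage \<Rightarrow> 'm \<Rightarrow> 'w \<Rightarrow> int" where
  "A_mat n I i j = int n - int (r_M I i j)"

definition B_mat :: "nat \<Rightarrow> ('m, 'w) marriage \<Rightarrow> 'm \<Rightarrow> 'w \<Rightarrow> int" where
  "B_mat n I i j = int n - int (r_W I j i)"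

definition depth_M :: "nat \<Rightarrow> ('m, 'w) marriage \<Rightarrow> 'w set \<Rightarrow> 'm \<Rightarrow> int" where
  "depth_M n I Sw i = Min ((\<lambda>j. A_mat n I i j) ` Sw)"

definition depth_W :: "nat \<Rightarrow> ('m, 'w) marriage \<Rightarrow> 'm set \<Rightarrow> 'w \<Rightarrow> int" where
  "depth_W n I Sm j = Min ((\<lambda>i. B_mat n I i j) ` Sm)"

definition C_set :: "nat \<Rightarrow> ('m, 'w) marriage \<Rightarrow> 'w set \<Rightarrow> 'm \<Rightarrow> 'w set" where
  "C_set n I Sw i = {w \<in> women I - Sw. A_mat n I i w < depth_M n I Sw i}"

definition D_set :: "nat \<Rightarrow> ('m, 'w) marriage \<Rightarrow> 'm set \<Rightarrow> 'w \<Rightarrow> 'm set" where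
  "D_set n I Sm j = {i \<in> men I - Sm. B_mat n I i j < depth_W n I Sm j}"

text \<open>
  The \<open>t\<close>-th smallest value, counted from \<open>t = 1\<close> and with multiplicity, of the
  family \<open>f\<close> on the finite set \<open>S\<close>; meaningful for \<open>1 \<le> t \<le> card S\<close>.
\<close>

definition order_stat :: "('a \<Rightarrow> 'b::linorder) \<Rightarrow> 'a set \<Rightarrow> nat \<Rightarrow> 'b" where
  "order_stat f S t = sorted_list_of_multiset (image_mset f (mset_set S)) ! (t - 1)"

definition full_hall :: "('a \<Rightarrow> 'b set) \<Rightarrow> 'a set \<Rightarrow> bool" where
  "full_hall F S \<longleftrightarrow> (\<forall>X. X \<subseteq> S \<longrightarrow> card (\<Union>x\<in>X. F x) \<ge> card X)"

text \<open>
  A bipartite graph is given by its edge set, each edge being written as the pair of its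
  left and its right endpoint.
\<close>

definition bipartite_edges :: "'a set \<Rightarrow> 'b set \<Rightarrow> ('a \<Rightarrow> 'b \<Rightarrow> bool) \<Rightarrow> ('a \<times> 'b) set" where
  "bipartite_edges S T adj = {(x, y). x \<in> S \<and> y \<in> T \<and> adj x y}"

definition is_matching :: "('a \<times> 'b) set \<Rightarrow> ('a \<times> 'b) set \<Rightarrow> bool" where
  "is_matching E N \<longleftrightarrow> N \<subseteq> E \<and>
     (\<forall>e\<in>N. \<forall>f\<in>N. e \<noteq> f \<longrightarrow> fst e \<noteq> fst f \<and> snd e \<noteq> snd f)"

definition saturates_left :: "('a \<times> 'b) set \<Rightarrow> 'a set \<Rightarrow> bool" where
  "saturates_left N S \<longleftrightarrow> (\<forall>x\<in>S. \<exists>e\<in>N. fst e = x)"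

end

theory Submission
  imports Defs
begin

text \<open>
  In a strict complete list the ranks are exactly \<open>1, \<dots>, n\<close>, so \<open>C\<^sub>i(S\<^sub>w)\<close> has exactly
  \<open>\<alpha>\<^sub>i\<close> elements. Among any \<open>k\<close> men the largest depth is at least the \<open>k\<close>-th
  smallest depth overall, hence at least \<open>k\<close>: every \<open>X\<close> has a member whose own set already has
  \<open>card X\<close> elements. This gives Hall's condition at once, and it also makes Hall's theorem
  unnecessary, since a member with the largest set can always be matched last.
\<close>

text \<open>If all of \<open>X\<close> lay strictly below the value \<open>v\<close> at index
  \<open>card X - 1\<close> of the sorted list (indices start at 0), at least \<open>card X\<close>
  entries would be smaller than \<open>v\<close>, yet only the \<open>card X - 1\<close> positions
  before it can hold such entries.\<close>

lemma exists_ge_order_stat: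
  fixes f :: "'a \<Rightarrow> 'b::linorder"
  assumes "finite S" and "X \<subseteq> S" and "X \<noteq> {}"
  shows "\<exists>x\<in>X. order_stat f S (card X) \<le> f x"
proof (rule ccontr)
  define L where "L = sorted_list_of_multiset (image_mset f (mset_set S))"
  define v where "v = L ! (card X - 1)"
  assume "\<not> ?thesis"
  then have less: "f x < v" if "x \<in> X" for x
    using that by (auto simp: order_stat_def L_def v_def not_le)
  have finX: "finite X" using assms finite_subset by blast
  then have cX: "card X > 0" using assms by (simp add: card_gt_0_iff)
  have "card X \<le> card {x \<in> S. f x < v}"
    using assms less by (intro card_mono) auto
  \<comment> \<open>Passing to the multiset image keeps members of \<open>S\<close> with equal
    values of \<open>f\<close> apart, so the count survives the move to the list.\<close>
  also have "\<dots> = size (filter_mset (\<lambda>y. y < v) (mset L))"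
    using assms(1) by (simp add: L_def filter_mset_image_mset filter_mset_mset_set)
  also have "\<dots> = length (filter (\<lambda>y. y < v) L)"
    by (simp flip: mset_filter)
  also have "\<dots> = card {i. i < length L \<and> L ! i < v}"
    by (rule length_filter_conv_card)
  also have "\<dots> \<le> card {..<card X - 1}"
  proof (intro card_mono subsetI)
    fix i assume i: "i \<in> {i. i < length L \<and> L ! i < v}"
    have "sorted L" by (simp add: L_def)
    then have "v \<le> L ! i" if "card X - 1 \<le> i"
      using that i by (auto simp: v_def intro: sorted_nth_mono)
    then show "i \<in> {..<card X - 1}" using i by force
  qed simp
  finally show False using cX by simp
qed

text \<open>Along \<open>r\<close> the set of predecessors grows strictly: transitivity gives
  inclusion, irreflexivity makes the smaller element a new predecessor. With totality the ranks are
  therefore distinct. No element precedes itself, so ranks are at most \<open>card X\<close>, and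
  equal cardinalities give surjectivity.\<close>

lemma bij_betw_rank_in:
  assumes fin: "finite X" and lin: "strict_linear_order_on X r"
  shows "bij_betw (rank_in X r) X {1..card X}"
proof -
  have tr: "trans r" and ir: "irrefl r" and tot: "total_on X r"
    using lin by (auto simp: strict_linear_order_on_def)
  have mono: "rank_in X r x < rank_in X r y" if "x \<in> X" "(x, y) \<in> r" for x y
  proof -
    have "{z \<in> X. (z, x) \<in> r} \<subset> {z \<in> X. (z, y) \<in> r}"
    proof (rule psubsetI)
      show "{z \<in> X. (z, x) \<in> r} \<subseteq> {z \<in> X. (z, y) \<in> r}"
        using transD[OF tr _ that(2)] by blast
      show "{z \<in> X. (z, x) \<in> r} \<noteq> {z \<in> X. (z, y) \<in> r}"
        using that ir unfolding irrefl_def by blast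
    qed
    then show ?thesis using fin by (simp add: rank_in_def psubset_card_mono)
  qed
  have inj: "inj_on (rank_in X r) X"
  proof (rule inj_onI, rule ccontr)
    fix x y assume "x \<in> X" "y \<in> X" "rank_in X r x = rank_in X r y" "x \<noteq> y"
    then show False
      using tot mono[of x y] mono[of y x] unfolding total_on_def by (metis less_irrefl)
  qed
  have sub: "rank_in X r ` X \<subseteq> {1..card X}"
  proof
    fix k assume "k \<in> rank_in X r ` X"
    then obtain x where x: "x \<in> X" "k = rank_in X r x" by blast
    have "{z \<in> X. (z, x) \<in> r} \<subset> X" using x(1) ir unfolding irrefl_def by blast
    then have "card {z \<in> X. (z, x) \<in> r} < card X" by (rule psubset_card_mono[OF fin])
    then show "k \<in> {1..card X}" using x(2) by (simp add: rank_in_def)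
  qed
  have "rank_in X r ` X = {1..card X}"
    by (intro card_subset_eq[OF _ sub]) (simp_all add: card_image[OF inj])
  with inj show ?thesis by (simp add: bij_betw_def)
qed

text \<open>Bridge from the complement form of the depths to the rank form of the edge relation:
  complementing reverses the order.\<close>

lemma Min_complement:
  fixes f :: "'a \<Rightarrow> nat"
  assumes "finite T" and "T \<noteq> {}"
  shows "Min ((\<lambda>x. int n - int (f x)) ` T) = int n - int (Max (f ` T))"
proof (rule Min_eqI)
  show "int n - int (Max (f ` T)) \<le> y" if "y \<in> (\<lambda>x. int n - int (f x)) ` T" for y
    using that assms by auto
  have "Max (f ` T) \<in> f ` T" using assms by (intro Max_in) auto
  then show "int n - int (Max (f ` T)) \<in> (\<lambda>x. int n - int (f x)) ` T" by auto
qed (use assms in simp)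

text \<open>Induction on \<open>card S\<close>; the hypothesis passes to subsets. Applied to
  \<open>S\<close> itself it yields an \<open>x\<close> to be served last: the others occupy at most
  \<open>card S - 1\<close> values, so \<open>C x\<close> still has a free one.\<close>

lemma exists_injective_choice:
  assumes "finite S"
    and "\<And>X. X \<subseteq> S \<Longrightarrow> X \<noteq> {} \<Longrightarrow> \<exists>x\<in>X. card X \<le> card (C x)"
  shows "\<exists>g. inj_on g S \<and> (\<forall>x\<in>S. g x \<in> C x)"
  using assms
proof (induction "card S" arbitrary: S)
  case 0
  then show ?case by simp
next
  case (Suc k)
  then obtain x where x: "x \<in> S" "card S \<le> card (C x)"
    using Suc.prems(2)[of S] by force
  define S' where "S' = S - {x}"
  have S': "finite S'" "card S' = k" "S = insert x S'" "x \<notin> S'" "S' \<subseteq> S"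
    using Suc.hyps(2) Suc.prems(1) x by (auto simp: S'_def)
  have "\<exists>g. inj_on g S' \<and> (\<forall>y\<in>S'. g y \<in> C y)"
    using S' Suc.prems(2) by (intro Suc.hyps(1)) auto
  then obtain g where g: "inj_on g S'" "\<forall>y\<in>S'. g y \<in> C y" by blast
  have "\<not> C x \<subseteq> g ` S'"
    using card_mono[of "g ` S'" "C x"] card_image_le[OF S'(1), of g] S'(1,2) x(2) Suc.hyps(2)
    by auto
  then obtain w where w: "w \<in> C x" "w \<notin> g ` S'" by blast
  have "inj_on (g(x := w)) S" "\<forall>y\<in>S. (g(x := w)) y \<in> C y"
    using g w S' by (auto simp: inj_on_def)
  then show ?case by blast
qed

lemma saturating_matching_of_choice:
  assumes "inj_on g S" and "\<And>x. x \<in> S \<Longrightarrow> g x \<in> T \<and> adj x (g x)"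
  shows "\<exists>N. is_matching (bipartite_edges S T adj) N \<and> saturates_left N S"
proof (intro exI conjI)
  let ?N = "(\<lambda>x. (x, g x)) ` S"
  show "is_matching (bipartite_edges S T adj) ?N"
    using assms by (auto simp: is_matching_def bipartite_edges_def inj_on_def)
  show "saturates_left ?N S" by (auto simp: saturates_left_def)
qed

lemma below_depth_iff:
  fixes p :: "'b \<Rightarrow> nat"
  assumes "finite T" and "T \<noteq> {}"
  shows "int n - int (p w) < Min ((\<lambda>x. int n - int (p x)) ` T) \<longleftrightarrow> Max (p ` T) < p w"
  by (simp add: Min_complement[OF assms])

text \<open>Lying below the depth means having rank above \<open>Max (p\<close>
  T)\<open>. As\<close>p\<open>is a bijection onto\<close>{1..n}\<open>, exactly\<close>n - Max (p
  \<open>T)\<close> elements do, and none of them is in \<open>T\<close>.\<close>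

lemma card_below_depth:
  fixes p :: "'b \<Rightarrow> nat"
  assumes fin: "finite U" and bij: "bij_betw p U {1..n}" and T: "T \<subseteq> U" "T \<noteq> {}"
  shows "int (card {w \<in> U - T. int n - int (p w) < Min ((\<lambda>x. int n - int (p x)) ` T)})
    = Min ((\<lambda>x. int n - int (p x)) ` T)"
proof -
  have finT: "finite T" using fin T finite_subset by blast
  let ?m = "Max (p ` T)"
  \<comment> \<open>The bound \<open>?m \<le> n\<close> makes the truncated difference
    \<open>n - ?m\<close> agree with the integer depth.\<close>
  have "?m \<in> p ` T" using finT T by (intro Max_in) auto
  also have "\<dots> \<subseteq> {1..n}" using bij T by (auto simp: bij_betw_def)
  finally have m: "?m \<le> n" by simp
  have "{w \<in> U - T. ?m < p w} = {w \<in> U. ?m < p w}"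
    using finT by (auto simp flip: not_le)
  moreover have "p ` {w \<in> U. ?m < p w} = {?m<..n}"
  proof -
    have "p ` {w \<in> U. ?m < p w} = {k \<in> p ` U. ?m < k}" by blast
    then show ?thesis using bij by (auto simp: bij_betw_def)
  qed
  moreover have "inj_on p {w \<in> U. ?m < p w}"
    by (rule inj_on_subset[OF bij_betw_imp_inj_on[OF bij]]) blast
  ultimately have "card {w \<in> U - T. ?m < p w} = n - ?m"
    by (metis card_greaterThanAtMost card_image)
  then show ?thesis
    using m by (simp add: below_depth_iff[OF finT T(2)] Min_complement[OF finT T(2)])
qed

text \<open>Stated for an arbitrary family of rankings \<open>p\<close>, so that the men's and the
  women's halves are two instances of it.\<close>

lemma hall_and_matching_of_depths:
  fixes p :: "'a \<Rightarrow> 'b \<Rightarrow> nat"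
  assumes finS: "finite S" and finU: "finite U" and T: "T \<subseteq> U" "T \<noteq> {}"
    and bij: "\<And>i. i \<in> S \<Longrightarrow> bij_betw (p i) U {1..n}"
    and d: "\<And>i. d i = Min ((\<lambda>x. int n - int (p i x)) ` T)"
    and C: "\<And>i. C i = {w \<in> U - T. int n - int (p i w) < d i}"
    and stat: "\<forall>t\<in>{1..card S}. int t \<le> order_stat d S t"
  shows "full_hall C S \<and>
    (\<exists>N. is_matching (bipartite_edges S (U - T) (\<lambda>i w. Max (p i ` T) < p i w)) N \<and>
      saturates_left N S)"
proof
  have finT: "finite T" using finU T finite_subset by blast
  have large: "\<exists>i\<in>X. card X \<le> card (C i)" if X: "X \<subseteq> S" "X \<noteq> {}" for X
  proof -
    obtain i where i: "i \<in> X" "order_stat d S (card X) \<le> d i"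
      using exists_ge_order_stat[OF finS X] by blast
    have "card X \<in> {1..card S}"
      using X finS card_mono[OF finS X(1)] finite_subset[OF X(1) finS]
      by (simp add: Suc_le_eq card_gt_0_iff)
    \<comment> \<open>The depth condition is used at \<open>t = card X\<close>, which lies in range
      because \<open>X\<close> is nonempty.\<close>
    then have "int (card X) \<le> d i" using stat i by fastforce
    also have "\<dots> = int (card (C i))"
      using card_below_depth[OF finU bij T] i X by (auto simp: C d)
    finally show ?thesis using i by auto
  qed
  show "full_hall C S"
    unfolding full_hall_def
  proof (intro allI impI)
    fix X assume X: "X \<subseteq> S"
    show "card X \<le> card (\<Union>x\<in>X. C x)"
    proof (cases "X = {}")
      case False
      then obtain i where i: "i \<in> X" "card X \<le> card (C i)" using large X by blast
      \<comment> \<open>This keeps the union finite, as monotonicity of \<open>card\<close>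
        requires.\<close>
      have "(\<Union>x\<in>X. C x) \<subseteq> U" by (auto simp: C)
      then have "card (C i) \<le> card (\<Union>x\<in>X. C x)"
        using i finU by (intro card_mono) (auto intro: finite_subset)
      with i show ?thesis by simp
    qed simp
  qed
  obtain g where "inj_on g S" "\<forall>i\<in>S. g i \<in> C i"
    using exists_injective_choice[OF finS large] by blast
  then show "\<exists>N. is_matching (bipartite_edges S (U - T) (\<lambda>i w. Max (p i ` T) < p i w)) N \<and>
      saturates_left N S"
    by (intro saturating_matching_of_choice[of g])
      (auto simp: C d below_depth_iff[OF finT T(2)])
qed

theorem lemma6p3:
  fixes I :: "('m, 'w) marriage" and n a b :: nat
    and Sm :: "'m set" and Sw :: "'w set"
  assumes "marriage_instance n I"
    and "Sm \<subseteq> men I" and "Sm \<noteq> {}" and "a = card Sm"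
    and "Sw \<subseteq> women I" and "Sw \<noteq> {}" and "b = card Sw"
  shows
    "((\<forall>t\<in>{1..a}. order_stat (depth_M n I Sw) Sm t \<ge> int t) \<longrightarrow>
        full_hall (C_set n I Sw) Sm \<and>
        (\<exists>N. is_matching
               (bipartite_edges Sm (women I - Sw)
                  (\<lambda>i w. r_M I i w > Max ((\<lambda>j. r_M I i j) ` Sw))) N \<and>
             saturates_left N Sm)) \<and>
     (\<forall>i\<in>Sm. \<forall>w\<in>women I - Sw.
        r_M I i w > Max ((\<lambda>j. r_M I i j) ` Sw) \<longleftrightarrow> w \<in> C_set n I Sw i) \<and>
     ((\<forall>t\<in>{1..b}. order_stat (depth_W n I Sm) Sw t \<ge> int t) \<longrightarrow>
        full_hall (D_set n I Sm) Sw \<and>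
        (\<exists>N. is_matching
               (bipartite_edges Sw (men I - Sm)
                  (\<lambda>j i'. r_W I j i' > Max ((\<lambda>i. r_W I j i) ` Sm))) N \<and>
             saturates_left N Sw)) \<and>
     (\<forall>j\<in>Sw. \<forall>i'\<in>men I - Sm.
        r_W I j i' > Max ((\<lambda>i. r_W I j i) ` Sm) \<longleftrightarrow> i' \<in> D_set n I Sm j)"
proof -
  note inst = assms(1)[unfolded marriage_instance_def]
  have fin: "finite (men I)" "finite (women I)" "finite Sm" "finite Sw"
    using inst assms by (auto intro: finite_subset)
  have bij_M: "bij_betw (r_M I i) (women I) {1..n}" if "i \<in> Sm" for i
    using bij_betw_rank_in[of "women I" "men_pref I i"] inst assms(2) that
    by (auto simp: r_M_def[abs_def])
  have bij_W: "bij_betw (r_W I j) (men I) {1..n}" if "j \<in> Sw" for j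
    using bij_betw_rank_in[of "men I" "women_pref I j"] inst assms(5) that
    by (auto simp: r_W_def[abs_def])
  have C_iff: "r_M I i w > Max (r_M I i ` Sw) \<longleftrightarrow> w \<in> C_set n I Sw i"
    if "w \<in> women I - Sw" for i w
    using that below_depth_iff[OF fin(4) assms(6)]
    by (simp add: C_set_def depth_M_def A_mat_def)
  have D_iff: "r_W I j i > Max (r_W I j ` Sm) \<longleftrightarrow> i \<in> D_set n I Sm j"
    if "i \<in> men I - Sm" for j i
    using that below_depth_iff[OF fin(3) assms(3)]
    by (simp add: D_set_def depth_W_def B_mat_def)
  show ?thesis
    unfolding assms(4,7)
  \<comment> \<open>The composed rule fits only the outer fourfold conjunction, so each implication
    keeps its conclusion whole; the two edge equivalences are left to the end.\<close>
  proof (intro conjI[OF impI conjI[OF _ conjI[OF impI]]])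
    assume "\<forall>t\<in>{1..card Sm}. int t \<le> order_stat (depth_M n I Sw) Sm t"
    then show "full_hall (C_set n I Sw) Sm \<and>
      (\<exists>N. is_matching (bipartite_edges Sm (women I - Sw) (\<lambda>i w. Max (r_M I i ` Sw) < r_M I i w)) N \<and>
        saturates_left N Sm)"
      by (intro hall_and_matching_of_depths[OF fin(3,2) assms(5,6) bij_M])
        (auto simp: C_set_def depth_M_def A_mat_def)
  next
    assume "\<forall>t\<in>{1..card Sw}. int t \<le> order_stat (depth_W n I Sm) Sw t"
    then show "full_hall (D_set n I Sm) Sw \<and>
      (\<exists>N. is_matching (bipartite_edges Sw (men I - Sm) (\<lambda>j i. Max (r_W I j ` Sm) < r_W I j i)) N \<and>
        saturates_left N Sw)"
      \<comment> \<open>Here women are the left side. \<open>B_mat\<close> takes the man first, but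
        unfolds to \<open>r_W I j i\<close> with the woman first, as the ranking family
        needs.\<close>
      by (intro hall_and_matching_of_depths[OF fin(4,1) assms(2,3) bij_W])
        (auto simp: D_set_def depth_W_def B_mat_def)
  qed (use C_iff D_iff in blast)+
qed

end
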